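(* For every $\varepsilon>0$ there exists an instance $\mathcal{I}$ of the Strip Packing Problem such that $$\frac{h_{\text{BL}}^{\text{best}}(\mathcal{I})}{h_{\text{OPT}}(\mathcal{I})}\ \ge\ \frac43-\varepsilon ;$$ i.e., the approximation ratio of the bottom-left algorithm for the Strip Packing Problem cannot be better than $4/3-\varepsilon$, even if the rectangles are ordered in the best possible way.
   Context: Strip Packing Problem (SPP): given a strip width $W>0$ and rectangles $r_1,\dots,r_n$ with widths $w_i\le W$ and heights $h_i$, a packing assigns to each $r_i$ a lower-left corner $(x_i,y_i)$; it is feasible if $x_i\ge 0$, $x_i+w_i\le W$, $y_i\ge 0$ for all $i$, and the open rectangles $(x_i,x_i+w_i)\times(y_i,y_i+h_i)$ are pairwise disjoint. Rotations are not allowed. The height of a packing is $\max_i (y_i+h_i)$, and $h_{\text{OPT}}(\mathcal{I})$ is the minimum height of a feasible packing. Bottom-left algorithm: given an ordering $r_1,\dots,r_n$, place $r_1$ at $(0,0)$. Then, for $i=2,\dots,n$, place $r_i$ at a position $(x_i,y_i)$ such that the first $i$ rectangles form a feasible packing and $(y_i,x_i)$ is lexicographically minimal among all such positions. $h_{\text{BL}}^{\text{best}}(\mathcal{I})$ denotes the minimum, over all $n!$ orderings, of the height of the packing produced by the bottom-left algorithm. *)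

theory Defs
  imports "HOL-Analysis.Analysis" "HOL-Combinatorics.List_Permutation"
begin

text \<open>An instance: strip width W and a list of rectangles (w_i, h_i).
  A placement is a list of lower-left corners (x_i, y_i) of the same length.\<close>

type_synonym rect = "real \<times> real"   (* (width, height) *)
type_synonym pos  = "real \<times> real"   (* (x, y) lower-left corner *)

definition valid_instance :: "real \<Rightarrow> rect list \<Rightarrow> bool" where
  "valid_instance W rs \<longleftrightarrow> W > 0 \<and> rs \<noteq> [] \<and>
     (\<forall>r\<in>set rs. 0 < fst r \<and> fst r \<le> W \<and> 0 < snd r)"

definition disjoint_open :: "rect \<Rightarrow> pos \<Rightarrow> rect \<Rightarrow> pos \<Rightarrow> bool" where
  "disjoint_open r p r' p' \<longleftrightarrow>
     ({fst p<..<fst p + fst r} \<times> {snd p<..<snd p + snd r}) \<inter>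
     ({fst p'<..<fst p' + fst r'} \<times> {snd p'<..<snd p' + snd r'}) = {}"

definition feasible :: "real \<Rightarrow> rect list \<Rightarrow> pos list \<Rightarrow> bool" where
  "feasible W rs ps \<longleftrightarrow> length ps = length rs \<and>
     (\<forall>i<length rs. 0 \<le> fst (ps!i) \<and> fst (ps!i) + fst (rs!i) \<le> W \<and> 0 \<le> snd (ps!i)) \<and>
     (\<forall>i<length rs. \<forall>j<length rs. i \<noteq> j \<longrightarrow> disjoint_open (rs!i) (ps!i) (rs!j) (ps!j))"

definition packing_height :: "rect list \<Rightarrow> pos list \<Rightarrow> real" where
  "packing_height rs ps = Max {snd (ps!i) + snd (rs!i) | i. i < length rs}"

definition h_OPT :: "real \<Rightarrow> rect list \<Rightarrow> real" where
  "h_OPT W rs = Inf {packing_height rs ps | ps. feasible W rs ps}"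

definition lex_yx_le :: "pos \<Rightarrow> pos \<Rightarrow> bool" where
  "lex_yx_le p q \<longleftrightarrow> snd p < snd q \<or> (snd p = snd q \<and> fst p \<le> fst q)"

definition BL_output :: "real \<Rightarrow> rect list \<Rightarrow> pos list \<Rightarrow> bool" where
  "BL_output W rs ps \<longleftrightarrow> length ps = length rs \<and>
     (rs \<noteq> [] \<longrightarrow> ps!0 = (0, 0)) \<and>
     (\<forall>i. 0 < i \<and> i < length rs \<longrightarrow>
        feasible W (take (Suc i) rs) (take (Suc i) ps) \<and>
        (\<forall>q. feasible W (take (Suc i) rs) (take i ps @ [q]) \<longrightarrow> lex_yx_le (ps!i) q))"

definition h_BL_best :: "real \<Rightarrow> rect list \<Rightarrow> real" where
  "h_BL_best W rs = Inf {packing_height rs' ps | rs' ps.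
                         mset rs' = mset rs \<and> BL_output W rs' ps}"

end

theory Submission
  imports Defs
begin

text \<open>The instance has strip width 13 and total area just above 39: two tall items of size
  \<open>4 \<times> (2 + d)\<close>, one of size \<open>4 \<times> 1\<close>, one of size \<open>1 \<times> (1 + 2 * d)\<close> and six of size \<open>3 \<times> 1\<close>.

  In a packing of height \<open>4 * c\<close> with \<open>c < 1\<close>, consider the horizontal lines at heights
  \<open>c\<close>, \<open>2 * c\<close>, \<open>3 * c\<close>. Every item crosses one of them and the tall ones cross two, so the total
  crossed width is at least \<open>39 = 3 * 13\<close>: each line is tiled exactly. Divisibility by 3 then
  leaves only four layouts: the middle line carries the two tall items at the two ends of the
  strip and the items of widths 4 and 1 between them, and the upper line carries three items of
  width 3 and one tall item. In each layout some item \<open>z\<close> of width 4 on the middle line has no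
  item of width 3 left-aligned with it above, but has a left neighbour with a strictly
  higher top. The first item placed above \<open>z\<close> could have been put left-aligned directly onto
  \<open>z\<close>, so under the bottom-left rule it rests at the height of \<open>z\<close> and straddles the left end of
  \<open>z\<close>, where the neighbour is in its way.\<close>

section \<open>Feasibility and the bottom-left rule\<close>

text \<open>The non-strict inequalities make this a closed condition on the positions, as the
  compactness argument for bottom-left positions requires.\<close>

definition apart :: "rect \<Rightarrow> pos \<Rightarrow> rect \<Rightarrow> pos \<Rightarrow> bool" where
  "apart r p r' p' \<longleftrightarrow> fst p + fst r \<le> fst p' \<or> fst p' + fst r' \<le> fst p \<or>
     snd p + snd r \<le> snd p' \<or> snd p' + snd r' \<le> snd p"

lemma greaterThanLessThan_disjoint_iff:
  fixes a b c d :: real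
  assumes "a < b" "c < d"
  shows "{a<..<b} \<inter> {c<..<d} = {} \<longleftrightarrow> b \<le> c \<or> d \<le> a"
proof -
  have "{a<..<b} \<inter> {c<..<d} = {max a c<..<min b d}" by auto
  then show ?thesis using assms by auto
qed

lemma disjoint_open_iff_apart:
  assumes "0 < fst r" "0 < snd r" "0 < fst r'" "0 < snd r'"
  shows "disjoint_open r p r' p' \<longleftrightarrow> apart r p r' p'"
  using assms
  by (simp add: disjoint_open_def apart_def Times_Int_Times greaterThanLessThan_disjoint_iff
      del: Int_greaterThanLessThan)

lemma disjoint_open_sym: "disjoint_open r p r' p' \<Longrightarrow> disjoint_open r' p' r p"
  unfolding disjoint_open_def by (simp add: Int_commute)

lemma feasible_snoc:
  assumes "length ps = length rs"
  shows "feasible W (rs @ [r]) (ps @ [q]) \<longleftrightarrow> feasible W rs ps \<and>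
    0 \<le> fst q \<and> fst q + fst r \<le> W \<and> 0 \<le> snd q \<and>
    (\<forall>j<length rs. disjoint_open r q (rs ! j) (ps ! j))"
  using assms unfolding feasible_def
  by (auto simp: nth_append less_Suc_eq intro: disjoint_open_sym)

text \<open>The free positions form a closed set containing \<open>(0, Y)\<close>, where
  \<open>Y\<close> is the sum of all tops. Minimising \<open>snd\<close> and then \<open>fst\<close>
  over its compact part up to height \<open>Y\<close> yields the lexicographic minimum.\<close>

lemma bottom_left_position_exists:
  assumes f: "feasible W rs ps" and pos: "\<forall>r\<in>set (rs @ [r]). 0 < fst r \<and> fst r \<le> W \<and> 0 < snd r"
  shows "\<exists>q. feasible W (rs @ [r]) (ps @ [q]) \<and>
    (\<forall>q'. feasible W (rs @ [r]) (ps @ [q']) \<longrightarrow> lex_yx_le q q')"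
proof -
  define n where "n = length rs"
  have len: "length ps = length rs" using f by (simp add: feasible_def)
  define S where "S = {q. 0 \<le> fst q \<and> fst q + fst r \<le> W \<and> 0 \<le> snd q \<and>
    (\<forall>j\<in>{..<n}. apart r q (rs ! j) (ps ! j))}"
  have S: "feasible W (rs @ [r]) (ps @ [q]) \<longleftrightarrow> q \<in> S" for q
    using f pos by (auto simp: feasible_snoc[OF len] S_def n_def disjoint_open_iff_apart)
  have "S = {q. 0 \<le> fst q \<and> fst q + fst r \<le> W \<and> 0 \<le> snd q} \<inter>
    (\<Inter>j<n. {q. apart r q (rs ! j) (ps ! j)})"
    by (auto simp: S_def)
  moreover have "closed {q. apart r q (rs ! j) (ps ! j)}" for j
    unfolding apart_def by (intro closed_Collect_disj closed_Collect_le continuous_intros)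
  moreover have "closed {q::pos. 0 \<le> fst q \<and> fst q + fst r \<le> W \<and> 0 \<le> snd q}"
    by (intro closed_Collect_conj closed_Collect_le continuous_intros)
  ultimately have clS: "closed S" by (simp add: closed_Int closed_INT)
  define Y where "Y = (\<Sum>j<n. snd (ps ! j) + snd (rs ! j))"
  have nonneg: "0 \<le> snd (ps ! j) + snd (rs ! j)" if "j < n" for j
  proof -
    have "0 \<le> snd (ps ! j)" using f that by (simp add: feasible_def n_def)
    moreover have "rs ! j \<in> set (rs @ [r])" using that by (simp add: n_def)
    then have "0 < snd (rs ! j)" using pos by blast
    ultimately show ?thesis by simp
  qed
  have top: "snd (ps ! j) + snd (rs ! j) \<le> Y" if "j < n" for j
    unfolding Y_def using that nonneg
    by (intro member_le_sum[where f = "\<lambda>j. snd (ps ! j) + snd (rs ! j)"]) auto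
  have "0 \<le> Y" unfolding Y_def using nonneg by (intro sum_nonneg) auto
  then have Y: "(0, Y) \<in> S" using pos top by (auto simp: S_def apart_def)
  define K where "K = S \<inter> {0..W} \<times> {0..Y}"
  have "compact K"
    unfolding K_def by (intro closed_Int_compact clS compact_Times compact_Icc)
  moreover have "(0, Y) \<in> K"
    using Y pos \<open>0 \<le> Y\<close> by (force simp: K_def)
  ultimately obtain p where p: "p \<in> K" "\<And>q. q \<in> K \<Longrightarrow> snd p \<le> snd q"
    using continuous_attains_inf[of K snd] continuous_on_snd[OF continuous_on_id] by blast
  define K' where "K' = K \<inter> {q. snd q = snd p}"
  have "compact K'"
    unfolding K'_def using \<open>compact K\<close>
    by (intro compact_Int_closed closed_Collect_eq continuous_intros) auto
  moreover have "p \<in> K'" using p by (simp add: K'_def)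
  ultimately obtain q where q: "q \<in> K'" "\<And>q'. q' \<in> K' \<Longrightarrow> fst q \<le> fst q'"
    using continuous_attains_inf[of K' fst] continuous_on_fst[OF continuous_on_id] by blast
  have "q \<in> S" "snd q = snd p" "snd p \<le> Y" using q p(1) by (auto simp: K'_def K_def)
  moreover have "lex_yx_le q q'" if "q' \<in> S" for q'
  proof (cases "snd q' \<le> snd p")
    case True
    then have "q' \<in> K"
      using that pos \<open>snd p \<le> Y\<close> by (cases q') (auto simp: K_def S_def)
    then have "snd q' = snd p" using p(2) True by (simp add: order_antisym)
    then have "fst q \<le> fst q'" using q(2) \<open>q' \<in> K\<close> by (simp add: K'_def)
    then show ?thesis using \<open>snd q = snd p\<close> \<open>snd q' = snd p\<close> by (simp add: lex_yx_le_def)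
  next
    case False
    then show ?thesis using \<open>snd q = snd p\<close> by (simp add: lex_yx_le_def)
  qed
  ultimately show ?thesis using S by blast
qed

text \<open>\<open>h_BL_best\<close> is an infimum over a set of reals; bounding it from below
  requires that set to be nonempty.\<close>

lemma BL_output_exists:
  assumes "\<forall>r\<in>set rs. 0 < fst r \<and> fst r \<le> W \<and> 0 < snd r"
  shows "\<exists>ps. BL_output W rs ps \<and> feasible W rs ps"
  using assms
proof (induction rs rule: rev_induct)
  case Nil
  then show ?case by (intro exI[of _ "[]"]) (simp add: BL_output_def feasible_def)
next
  case (snoc r rs)
  then obtain ps where ps: "BL_output W rs ps" "feasible W rs ps" by auto
  have len: "length ps = length rs" using ps by (simp add: BL_output_def)
  show ?case
  proof (cases "rs = []")
    case True
    have "feasible W [r] [(0, 0)]" using snoc.prems by (simp add: feasible_def)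
    moreover have "BL_output W [r] [(0, 0)]" by (simp add: BL_output_def)
    ultimately show ?thesis using True by auto
  next
    case False
    obtain q where q: "feasible W (rs @ [r]) (ps @ [q])"
      "\<And>q'. feasible W (rs @ [r]) (ps @ [q']) \<Longrightarrow> lex_yx_le q q'"
      using bottom_left_position_exists[OF ps(2) snoc.prems] by blast
    have "BL_output W (rs @ [r]) (ps @ [q])"
      unfolding BL_output_def
    proof (intro conjI impI allI)
      show "length (ps @ [q]) = length (rs @ [r])" using len by simp
      have "ps ! 0 = (0, 0)" using ps(1) False by (simp add: BL_output_def)
      then show "(ps @ [q]) ! 0 = (0, 0)" using False len by (simp add: nth_append)
    next
      fix i assume i: "0 < i \<and> i < length (rs @ [r])"
      show "feasible W (take (Suc i) (rs @ [r])) (take (Suc i) (ps @ [q]))"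
        using ps(1) q(1) i len by (cases "i = length rs") (simp_all add: BL_output_def)
      fix q' assume q': "feasible W (take (Suc i) (rs @ [r])) (take i (ps @ [q]) @ [q'])"
      show "lex_yx_le ((ps @ [q]) ! i) q'"
      proof (cases "i = length rs")
        case True
        then show ?thesis using q' q(2) len by (simp add: nth_append)
      next
        case False
        then have "i < length rs" "feasible W (take (Suc i) rs) (take i ps @ [q'])"
          using i q' len by simp_all
        moreover from this have "lex_yx_le (ps ! i) q'"
          using ps(1) i unfolding BL_output_def by blast
        ultimately show ?thesis using len by (simp add: nth_append)
      qed
    qed
    then show ?thesis using q by blast
  qed
qed

text \<open>\<open>BL_output\<close> asserts feasibility only for prefixes of length at least two,
  hence the bound on the length.\<close>

lemma BL_output_feasible:
  assumes "BL_output W rs ps" "1 < length rs"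
  shows "feasible W rs ps"
proof -
  have "feasible W (take (Suc (length rs - 1)) rs) (take (Suc (length rs - 1)) ps)"
    using assms unfolding BL_output_def by (metis diff_less zero_less_diff zero_less_one
        less_trans)
  then show ?thesis using assms by (simp add: BL_output_def)
qed

text \<open>This frees the rule from prefixes of lists: only earlier rectangles can block a
  competing spot. For \<open>i = 0\<close> the origin is least because \<open>q\<close> has
  nonnegative coordinates.\<close>

lemma BL_output_lex_least:
  assumes BL: "BL_output W rs ps" and f: "feasible W rs ps" and i: "i < length rs"
    and q: "0 \<le> fst q" "fst q + fst (rs ! i) \<le> W" "0 \<le> snd q"
      "\<And>j. j < i \<Longrightarrow> disjoint_open (rs ! i) q (rs ! j) (ps ! j)"
  shows "lex_yx_le (ps ! i) q"
proof (cases "i = 0")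
  case True
  then show ?thesis using BL i q by (auto simp: BL_output_def lex_yx_le_def)
next
  case False
  have len: "length ps = length rs" using BL by (simp add: BL_output_def)
  have "feasible W (take i rs) (take i ps)" using f i by (auto simp: feasible_def)
  then have "feasible W (take i rs @ [rs ! i]) (take i ps @ [q])"
    using i q len by (subst feasible_snoc) auto
  then have "feasible W (take (Suc i) rs) (take i ps @ [q])"
    using i by (simp add: take_Suc_conv_app_nth)
  then show ?thesis using BL i False unfolding BL_output_def by blast
qed

section \<open>Disjoint intervals\<close>

text \<open>Remove the interval with the largest left end \<open>x m\<close>: all others end by
  \<open>x m\<close>, so the induction applies to them with \<open>x m\<close> in place of
  \<open>b\<close>.\<close>

lemma sum_disjoint_intervals_le:
  fixes x w :: "'a \<Rightarrow> real"
  assumes "finite S" "a \<le> b" "\<And>k. k \<in> S \<Longrightarrow> a \<le> x k \<and> x k + w k \<le> b \<and> 0 < w k"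
    "\<And>j k. j \<in> S \<Longrightarrow> k \<in> S \<Longrightarrow> j \<noteq> k \<Longrightarrow> x j + w j \<le> x k \<or> x k + w k \<le> x j"
  shows "sum w S \<le> b - a"
  using assms
proof (induction S arbitrary: b rule: finite_remove_induct)
  case empty
  then show ?case by simp
next
  case (remove S)
  have "Max (x ` S) \<in> x ` S" using remove.hyps by (intro Max_in) auto
  then obtain m where m: "m \<in> S" "Max (x ` S) = x m" by auto
  have max: "x k \<le> x m" if "k \<in> S" for k
    unfolding m(2)[symmetric] using remove.hyps that by (intro Max_ge) auto
  have "x k + w k \<le> x m" if "k \<in> S - {m}" for k
    using remove.prems(2)[of m] remove.prems(3)[of k m] m(1) max[of k] that by auto
  then have "sum w (S - {m}) \<le> x m - a"
    using remove.prems m(1) by (intro remove.IH) auto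
  then show ?case
    using remove.prems(2)[OF m(1)] remove.hyps m(1) by (simp add: sum.remove)
qed

text \<open>The intervals on either side of interval \<open>k\<close> fit into the space on that
  side. As the total length is exhausted, both bounds are equalities.\<close>

lemma tiling_position:
  fixes x w :: "'a \<Rightarrow> real"
  assumes fin: "finite S" and S: "\<And>k. k \<in> S \<Longrightarrow> a \<le> x k \<and> x k + w k \<le> b \<and> 0 < w k"
    and disj: "\<And>j k. j \<in> S \<Longrightarrow> k \<in> S \<Longrightarrow> j \<noteq> k \<Longrightarrow> x j + w j \<le> x k \<or> x k + w k \<le> x j"
    and full: "sum w S = b - a" and k: "k \<in> S"
  shows "x k = a + (\<Sum>j\<in>S - {k}. if x j < x k then w j else 0)"
proof -
  let ?L = "{j \<in> S - {k}. x j < x k}" and ?R = "{j \<in> S - {k}. \<not> x j < x k}"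
  have "S = insert k (?L \<union> ?R)" using k by auto
  then have "sum w S = sum w (insert k (?L \<union> ?R))" by simp
  also have "\<dots> = w k + (sum w ?L + sum w ?R)"
    using fin by (subst sum.insert) (auto intro: sum.union_disjoint)
  finally have split: "b - a = w k + (sum w ?L + sum w ?R)" using full by simp
  have L: "x j + w j \<le> x k" if "j \<in> ?L" for j
    using disj[of j k] S[of k] k that by force
  have R: "x k + w k \<le> x j" if "j \<in> ?R" for j
    using disj[of j k] S[of j] k that by force
  have "sum w ?L \<le> x k - a"
    using fin S[OF k] L S disj by (intro sum_disjoint_intervals_le[where x = x]) auto
  moreover have "sum w ?R \<le> b - (x k + w k)"
    using fin S[OF k] R S disj by (intro sum_disjoint_intervals_le[where x = x]) auto
  moreover have "sum w ?L = (\<Sum>j\<in>S - {k}. if x j < x k then w j else 0)"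
    using fin by (intro sum.inter_filter) simp
  ultimately show ?thesis using split by linarith
qed

section \<open>The instance\<close>

definition wd :: "nat \<Rightarrow> real" where
  "wd k = (if k < 3 then 4 else if k = 3 then 1 else 3)"

text \<open>The terms in \<open>d\<close> separate the tops compared at the end: at most 2 for item
  2, \<open>2 + d\<close> for a tall item on the floor, at least \<open>2 + 2 * d\<close> for item
  3.\<close>

definition ht :: "real \<Rightarrow> nat \<Rightarrow> real" where
  "ht d k = (if k < 2 then 2 + d else if k = 3 then 1 + 2 * d else 1)"

definition items :: "real \<Rightarrow> rect list" where
  "items d = map (\<lambda>k. (wd k, ht d k)) [0..<10]"

lemma length_items [simp]: "length (items d) = 10"
  by (simp add: items_def)

lemma nth_items [simp]: "k < 10 \<Longrightarrow> items d ! k = (wd k, ht d k)"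
  by (simp add: items_def)

lemma wd_bounds: "0 < wd k" "wd k \<le> 4"
  by (auto simp: wd_def)

lemma ht_ge_1: "0 < d \<Longrightarrow> 1 \<le> ht d k"
  by (auto simp: ht_def)

lemma less_10_cases: "(k::nat) < 10 \<longleftrightarrow> k = 0 \<or> k = 1 \<or> k = 2 \<or> k = 3 \<or> k = 4 \<or> k = 5 \<or> k = 6
   \<or> k = 7 \<or> k = 8 \<or> k = 9"
  by auto

lemma items_valid:
  assumes "r \<in> set (items d)" "0 < d"
  shows "0 < fst r \<and> fst r \<le> 13 \<and> 0 < snd r"
  using assms ht_ge_1[OF assms(2)] by (auto simp: items_def wd_def ht_def)

text \<open>The last three items all sit at \<open>2 + 2 * d\<close>, the top of item 3, and thus
  hover over items 0 and 2; a bottom-left packing cannot imitate this.\<close>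

definition opt_pos :: "real \<Rightarrow> pos list" where
  "opt_pos d = [(0, 0), (9, 1), (4, 1), (8, 1), (4, 0), (7, 0), (10, 0),
     (0, 2 + 2 * d), (3, 2 + 2 * d), (6, 2 + 2 * d)]"

lemma feasible_opt_pos:
  assumes "0 < d"
  shows "feasible 13 (items d) (opt_pos d)"
proof -
  have pos: "0 < fst (items d ! k)" "0 < snd (items d ! k)" if "k < 10" for k
    using that assms by (auto simp: wd_def ht_def)
  have "apart (items d ! i) (opt_pos d ! i) (items d ! j) (opt_pos d ! j)"
    if "i < 10" "j < 10" "i \<noteq> j" for i j
    using that assms unfolding less_10_cases
    by (elim disjE) (simp_all add: apart_def opt_pos_def wd_def ht_def)
  then have "disjoint_open (items d ! i) (opt_pos d ! i) (items d ! j) (opt_pos d ! j)"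
    if "i < 10" "j < 10" "i \<noteq> j" for i j
    using that pos by (simp add: disjoint_open_iff_apart)
  moreover have "0 \<le> fst (opt_pos d ! i) \<and> fst (opt_pos d ! i) + fst (items d ! i) \<le> 13
     \<and> 0 \<le> snd (opt_pos d ! i)" if "i < 10" for i
    using that assms unfolding less_10_cases by (elim disjE) (simp_all add: opt_pos_def wd_def)
  ultimately show ?thesis by (simp add: feasible_def opt_pos_def)
qed

lemma packing_height_ge:
  assumes "i < length rs"
  shows "snd (ps ! i) + snd (rs ! i) \<le> packing_height rs ps"
  unfolding packing_height_def using assms by (intro Max_ge) auto

lemma packing_height_opt_pos:
  assumes "0 < d"
  shows "packing_height (items d) (opt_pos d) \<le> 3 + 2 * d"
proof -
  have "snd (opt_pos d ! i) + snd (items d ! i) \<le> 3 + 2 * d" if "i < 10" for i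
    using that assms unfolding less_10_cases
    by (elim disjE) (simp_all add: opt_pos_def ht_def)
  then show ?thesis unfolding packing_height_def by (intro Max.boundedI) (auto intro: exI[of _ 0])
qed

lemma h_OPT_items:
  assumes "0 < d"
  shows "0 < h_OPT 13 (items d)" "h_OPT 13 (items d) \<le> 3 + 2 * d"
proof -
  let ?A = "{packing_height (items d) ps | ps. feasible 13 (items d) ps}"
  have lower: "1 \<le> a" if "a \<in> ?A" for a
  proof -
    from that obtain ps where ps: "a = packing_height (items d) ps" "feasible 13 (items d) ps"
      by auto
    then have "0 \<le> snd (ps ! 0)" by (auto simp: feasible_def)
    moreover have "1 \<le> snd (items d ! 0)" using ht_ge_1[OF assms] by simp
    ultimately show ?thesis using packing_height_ge[of 0 "items d" ps] ps(1) by simp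
  qed
  have mem: "packing_height (items d) (opt_pos d) \<in> ?A"
    using feasible_opt_pos[OF assms] by auto
  have "1 \<le> Inf ?A" using mem lower by (intro cInf_greatest) auto
  then show "0 < h_OPT 13 (items d)" by (simp add: h_OPT_def)
  have "Inf ?A \<le> packing_height (items d) (opt_pos d)"
    using mem lower by (intro cInf_lower bdd_belowI[of _ 1]) auto
  then show "h_OPT 13 (items d) \<le> 3 + 2 * d"
    using packing_height_opt_pos[OF assms] by (simp add: h_OPT_def)
qed

section \<open>Bottom-left packings of height less than 4\<close>

text \<open>\<open>tm k\<close> is the time at which item \<open>k\<close> is placed, and \<open>4 * c\<close> bounds the height.\<close>

locale low_packing =
  fixes d c :: real and x y :: "nat \<Rightarrow> real" and tm :: "nat \<Rightarrow> nat"
  assumes d: "0 < d" and c: "0 < c" "c < 1"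
    and strip: "k < 10 \<Longrightarrow> 0 \<le> x k \<and> x k + wd k \<le> 13 \<and> 0 \<le> y k \<and> y k + ht d k \<le> 4 * c"
    and disj: "\<lbrakk>j < 10; k < 10; j \<noteq> k\<rbrakk> \<Longrightarrow>
      apart (wd j, ht d j) (x j, y j) (wd k, ht d k) (x k, y k)"
    and lex_least: "\<lbrakk>k < 10; 0 \<le> a; a + wd k \<le> 13; 0 \<le> b;
      \<And>j. \<lbrakk>j < 10; tm j < tm k\<rbrakk> \<Longrightarrow> apart (wd k, ht d k) (a, b) (wd j, ht d j) (x j, y j)\<rbrakk>
      \<Longrightarrow> y k < b \<or> (y k = b \<and> x k \<le> a)"
begin

section \<open>Items crossing the lines at heights \<open>c\<close>, \<open>2 * c\<close>,
  \<open>3 * c\<close>\<close>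

definition row :: "nat \<Rightarrow> nat set" where
  "row r = {k. k < 10 \<and> y k < real r * c \<and> real r * c < y k + ht d k}"

definition overlap :: "nat \<Rightarrow> nat \<Rightarrow> bool" where
  "overlap j k \<longleftrightarrow> x j < x k + wd k \<and> x k < x j + wd j"

lemma row_less: "k \<in> row r \<Longrightarrow> k < 10"
  by (simp add: row_def)

lemma row_finite [simp]: "finite (row r)"
  by (rule finite_subset[of _ "{..<10}"]) (auto simp: row_def)

text \<open>Rows are defined by strict inequalities, so the two interiors share a height and must be
  separated horizontally.\<close>

lemma row_no_overlap:
  assumes "j \<in> row r" "k \<in> row r" "j \<noteq> k"
  shows "\<not> overlap j k"
  using disj[of j k] assms by (auto simp: row_def overlap_def apart_def)

text \<open>Overlapping items are separated vertically, and the reverse order would put the line of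
  row \<open>s\<close> below that of row \<open>r\<close>.\<close>

lemma row_below:
  assumes "j \<in> row r" "k \<in> row s" "r < s" "overlap j k" "j \<noteq> k"
  shows "y j + ht d j \<le> y k"
proof -
  have "real r * c < real s * c" using assms c by simp
  then show ?thesis
    using assms disj[of j k] by (auto simp: row_def overlap_def apart_def)
qed

lemma row_disjoint:
  assumes "j \<in> row r" "k \<in> row r" "j \<noteq> k"
  shows "x j + wd j \<le> x k \<or> x k + wd k \<le> x j"
  using row_no_overlap[OF assms] by (auto simp: overlap_def)

lemma row_width: "sum wd (row r) \<le> 13"
  using sum_disjoint_intervals_le[of "row r" 0 13 x wd] strip row_disjoint wd_bounds row_less
  by auto

text \<open>The lines cut the packing into four slabs of height \<open>c < 1\<close>, too thin for
  an item of height at least 1.\<close>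

lemma in_some_row:
  assumes "k < 10"
  shows "k \<in> row 1 \<or> k \<in> row 2 \<or> k \<in> row 3"
proof (rule ccontr)
  assume "\<not> ?thesis"
  then show False using strip[OF assms] assms ht_ge_1[OF d, of k] c by (auto simp: row_def)
qed

text \<open>A height above \<open>2 * c\<close> fits neither in the lower or upper half nor between
  the first and the third line.\<close>

lemma tall_rows:
  assumes "k < 2"
  shows "k \<in> row 2" "k \<in> row 1 \<or> k \<in> row 3"
  using strip[of k] assms c d by (auto simp: row_def ht_def)

lemma sum_row: "sum wd (row r) = (\<Sum>k<10. wd k * of_bool (k \<in> row r))"
proof -
  have "row r = {k \<in> {..<10}. k \<in> row r}" by (auto simp: row_less)
  then have "sum wd (row r) = sum wd {k \<in> {..<10}. k \<in> row r}" by simp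
  also have "\<dots> = (\<Sum>k<10. if k \<in> row r then wd k else 0)"
    by (intro sum.inter_filter) simp
  finally show ?thesis by (simp add: of_bool_def if_distrib cong: if_cong)
qed

definition mult :: "nat \<Rightarrow> real" where
  "mult k = of_bool (k \<in> row 1) + of_bool (k \<in> row 2) + of_bool (k \<in> row 3)"

lemma mult_ge: "k < 10 \<Longrightarrow> (if k < 2 then 2 else 1) \<le> mult k"
  using in_some_row[of k] tall_rows[of k] by (auto simp: mult_def)

lemma sum_rows: "sum wd (row 1) + sum wd (row 2) + sum wd (row 3) = (\<Sum>k<10. wd k * mult k)"
  by (simp add: sum_row mult_def sum.distrib distrib_left)

lemma sum_min_mult: "(\<Sum>k<10. wd k * (if k < 2 then 2 else 1)) = 39"
  by (simp add: wd_def eval_nat_numeral)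

lemma sum_mult_ge: "39 \<le> (\<Sum>k<10. wd k * mult k)"
  unfolding sum_min_mult[symmetric] using mult_ge wd_bounds
  by (intro sum_mono mult_left_mono) (auto simp: less_imp_le)

text \<open>Three rows of width at most 13 have total width at least 39.\<close>

lemma row_full: "r \<in> {1, 2, 3} \<Longrightarrow> sum wd (row r) = 13"
  using row_width[of 1] row_width[of 2] row_width[of 3] sum_rows sum_mult_ge by auto

text \<open>All widths are positive, so a single surplus crossing would push the total above
  39.\<close>

lemma mult_eq:
  assumes "k < 10"
  shows "mult k = (if k < 2 then 2 else 1)"
proof (rule ccontr)
  assume "\<not> ?thesis"
  then have "(if k < 2 then 2 else 1) < mult k" using mult_ge[OF assms] by linarith
  then have "(\<Sum>k<10. wd k * (if k < 2 then 2 else 1)) < (\<Sum>k<10. wd k * mult k)"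
    using assms mult_ge wd_bounds
    by (intro sum_strict_mono_ex1) (auto simp: less_imp_le intro!: bexI[of _ k] mult_left_mono)
  then show False using sum_rows row_full[of 1] row_full[of 2] row_full[of 3] sum_min_mult by simp
qed

lemma row_position:
  assumes "k \<in> row r" "r \<in> {1, 2, 3}"
  shows "x k = (\<Sum>j\<in>row r - {k}. if x j < x k then wd j else 0)"
proof -
  have "x k = 0 + (\<Sum>j\<in>row r - {k}. if x j < x k then wd j else 0)"
    using assms strip row_disjoint wd_bounds row_less row_full
    by (intro tiling_position[where b = 13]) simp_all
  then show ?thesis by simp
qed

text \<open>Otherwise item \<open>k\<close> could be added to a row that already fills the
  strip.\<close>

lemma row_overlap_exists:
  assumes "k < 10" "r \<in> {1, 2, 3}"
  shows "\<exists>j\<in>row r. overlap j k"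
proof (rule ccontr)
  assume no: "\<not> ?thesis"
  then have k: "k \<notin> row r" using wd_bounds[of k] by (auto simp: overlap_def)
  have "sum wd (insert k (row r)) \<le> 13 - 0"
  proof (intro sum_disjoint_intervals_le[where x = x])
    show "0 \<le> x i \<and> x i + wd i \<le> 13 \<and> 0 < wd i" if "i \<in> insert k (row r)" for i
      using that strip[of i] assms(1) row_less[of i r] wd_bounds[of i] by auto
    show "x i + wd i \<le> x j \<or> x j + wd j \<le> x i"
      if "i \<in> insert k (row r)" "j \<in> insert k (row r)" "i \<noteq> j" for i j
      using that no row_disjoint[of i r j] by (auto simp: overlap_def not_less)
  qed simp_all
  then show False using k row_full[OF assms(2)] wd_bounds[of k] by simp
qed

section \<open>Contents of the three rows, by divisibility\<close>

text \<open>The tall items leave width 5, and \<open>4 + 1\<close> is the only way to fill it from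
  one 4, one 1 and any number of 3s.\<close>

lemma row_2: "row 2 = {0, 1, 2, 3}"
proof -
  define A where "A = {k. k \<in> row 2 \<and> 4 \<le> k}"
  have A: "finite A" "A \<inter> {0, 1, 2, 3} = {}" by (auto simp: A_def)
  have split: "row 2 = {0, 1} \<union> ({2, 3} \<inter> row 2) \<union> A"
    using tall_rows[of 0] tall_rows[of 1] by (auto simp: A_def)
  have "sum wd A = (\<Sum>k\<in>A. 3)" by (intro sum.cong) (auto simp: A_def wd_def)
  then have "sum wd A = real (3 * card A)" by simp
  moreover have "sum wd (row 2) = sum wd ({0, 1} \<union> ({2, 3} \<inter> row 2)) + sum wd A"
    using A by (subst split, intro sum.union_disjoint) auto
  moreover have "sum wd ({0, 1} \<union> ({2, 3} \<inter> row 2)) = real (8 +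
      (if 2 \<in> row 2 then 4 else 0) + (if 3 \<in> row 2 then 1 else 0))"
    by (auto simp: wd_def)
  \<comment> \<open>Both sides are casts of naturals, so that the equation can be solved in
    \<open>nat\<close>.\<close>
  ultimately have "real (8 + (if 2 \<in> row 2 then 4 else 0) + (if 3 \<in> row 2 then 1 else 0)
     + 3 * card A) = real 13"
    using row_full[of 2] by simp
  then have "8 + (if 2 \<in> row 2 then 4 else 0) + (if 3 \<in> row 2 then 1 else 0) + 3 * card A = (13::nat)"
    by (simp only: of_nat_eq_iff)
  then have "2 \<in> row 2 \<and> 3 \<in> row 2 \<and> card A = 0"
    by (auto split: if_splits) presburger+
  then show ?thesis using split A by auto
qed

lemma small_item_row_2:
  assumes "k < 10" "2 \<le> k" "k \<in> row 2"
  shows "k \<notin> row 1" "k \<notin> row 3"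
  using mult_eq[of k] assms by (auto simp: mult_def of_bool_def split: if_splits)

text \<open>Items 2 and 3 are spent on the middle line, and 13 minus 0, 4 or 8 is divisible by 3
  only for 4.\<close>

lemma outer_row_tall:
  assumes "r \<in> {1, 3}"
  shows "\<exists>t<2. row r \<inter> {..<4} = {t}"
proof -
  define A where "A = {k. k \<in> row r \<and> 4 \<le> k}"
  have no: "2 \<notin> row r" "3 \<notin> row r"
    using small_item_row_2[of 2] small_item_row_2[of 3] row_2 assms by auto
  have "sum wd A = (\<Sum>k\<in>A. 3)" by (intro sum.cong) (auto simp: A_def wd_def)
  then have "sum wd A = real (3 * card A)" by simp
  moreover have split: "row r = ({0, 1} \<inter> row r) \<union> A"
  proof -
    have "4 \<le> k" if "k \<in> row r" "k \<notin> {0, 1}" for k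
    proof -
      have "k \<noteq> 0" "k \<noteq> 1" "k \<noteq> 2" "k \<noteq> 3" using that no by auto
      then show ?thesis by presburger
    qed
    then show ?thesis by (auto simp: A_def)
  qed
  have "sum wd (row r) = sum wd ({0, 1} \<inter> row r) + sum wd A"
    by (subst split, intro sum.union_disjoint) (auto simp: A_def)
  moreover have "sum wd ({0, 1} \<inter> row r) = real ((if 0 \<in> row r then 4 else 0) +
      (if 1 \<in> row r then 4 else 0))"
    by (auto simp: wd_def)
  ultimately have "real ((if 0 \<in> row r then 4 else 0) + (if 1 \<in> row r then 4 else 0)
     + 3 * card A) = real 13"
    using row_full[of r] assms by auto
  then have "(if 0 \<in> row r then 4 else 0) + (if 1 \<in> row r then 4 else 0) + 3 * card A = (13::nat)"
    by (simp only: of_nat_eq_iff)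
  then have one: "0 \<in> row r \<longleftrightarrow> 1 \<notin> row r"
    by (auto split: if_splits) presburger+
  have "{..<4::nat} = {0, 1, 2, 3}" by auto
  then show ?thesis
    using one no by (cases "0 \<in> row r") (auto intro: exI[of _ 0] exI[of _ 1])
qed

text \<open>Each tall item crosses the middle line and exactly one other, so the tall items on the
  lower and upper lines differ.\<close>

lemma tall_split:
  obtains l u where "(l, u) = (0, 1) \<or> (l, u) = (1, 0)"
    "row 1 \<inter> {..<4} = {l}" "row 3 \<inter> {..<4} = {u}"
proof -
  obtain l u where lu: "l < 2" "u < 2" "row 1 \<inter> {..<4} = {l}" "row 3 \<inter> {..<4} = {u}"
    using outer_row_tall[of 1] outer_row_tall[of 3] by auto
  have "l \<noteq> u"
  proof
    assume "l = u"
    then have "l \<in> row 1" "l \<in> row 2" "l \<in> row 3" using lu tall_rows by auto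
    then show False using mult_eq[of l] lu by (simp add: mult_def)
  qed
  then have "(l, u) = (0, 1) \<or> (l, u) = (1, 0)"
    using lu(1,2) by (auto simp: less_2_cases_iff)
  then show thesis using that lu by blast
qed

text \<open>In a gapless row everything except \<open>t\<close> has width 3, so offsets are
  multiples of 3, shifted by \<open>wd t\<close> once \<open>t\<close> is passed.\<close>

lemma outer_row_position:
  assumes r: "r \<in> {1, 3}" and t: "row r \<inter> {..<4} = {t}" and k: "k \<in> row r"
  shows "\<exists>n. x k = 3 * real n + (if k \<noteq> t \<and> x t < x k then wd t else 0)"
proof -
  let ?f = "\<lambda>j. if x j < x k then wd j else 0"
  let ?B = "row r - {k} - {t}"
  have "wd j = 3" if "j \<in> ?B" for j
  proof -
    have "j \<notin> {..<4}" using t that by blast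
    then show ?thesis by (simp add: wd_def)
  qed
  then have "sum ?f ?B = (\<Sum>j\<in>?B. if x j < x k then 3 else 0)"
    by (intro sum.cong) simp_all
  also have "\<dots> = 3 * real (card {j \<in> ?B. x j < x k})"
    by (subst sum.inter_filter[symmetric]) auto
  finally have B: "sum ?f ?B = 3 * real (card {j \<in> ?B. x j < x k})" .
  have xk: "x k = sum ?f (row r - {k})" using row_position[OF k] r by auto
  show ?thesis
  proof (cases "k = t")
    case True
    then have "?B = row r - {k}" by auto
    then show ?thesis using B xk True by auto
  next
    case False
    then have "sum ?f (row r - {k}) = ?f t + sum ?f ?B"
      using t by (intro sum.remove) auto
    then show ?thesis using B xk False by (intro exI) (auto simp: add.commute)
  qed
qed

section \<open>Consequences of the bottom-left rule\<close>

text \<open>Any item overlapping \<open>k\<close> lies in a higher row and hence above it, so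
  \<open>k\<close> can drop straight to the floor.\<close>

lemma row_1_floor:
  assumes "k \<in> row 1"
  shows "y k = 0"
proof -
  have k: "k < 10" using assms row_less by blast
  have "apart (wd k, ht d k) (x k, 0) (wd j, ht d j) (x j, y j)" if "j < 10" "tm j < tm k" for j
  proof (cases "overlap k j")
    case True
    have "j \<noteq> k" using that by auto
    then have "j \<notin> row 1" using row_no_overlap[OF assms] True by blast
    then have "y k + ht d k \<le> y j"
      using in_some_row[OF that(1)] row_below[OF assms _ _ True] \<open>j \<noteq> k\<close> by fastforce
    then show ?thesis using strip[OF k] by (auto simp: apart_def)
  qed (auto simp: apart_def overlap_def)
  then have "y k < 0 \<or> (y k = 0 \<and> x k \<le> x k)" using strip[OF k] k by (intro lex_least) auto
  then show ?thesis using strip[OF k] by auto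
qed

text \<open>If item 2 were higher it could drop to height 1: the items beneath it belong to row 1,
  stand on the floor and have height 1, since those of other heights share row 2 with it.\<close>

lemma low_item_bottom: "y 2 \<le> 1"
proof (rule ccontr)
  assume high: "\<not> y 2 \<le> 1"
  have two: "2 \<in> row 2" by (simp add: row_2)
  have "apart (wd 2, ht d 2) (x 2, 1) (wd j, ht d j) (x j, y j)" if "j < 10" "tm j < tm 2" for j
  proof (cases "overlap 2 j")
    case True
    have "j \<noteq> 2" using that by auto
    then have not2: "j \<notin> row 2" using row_no_overlap[OF two] True by blast
    then have "j \<notin> {0, 1, 3}" by (auto simp: row_2)
    with \<open>j \<noteq> 2\<close> have j: "ht d j = 1" by (auto simp: ht_def less_2_cases_iff)
    from not2 in_some_row[OF that(1)] consider "j \<in> row 1" | "j \<in> row 3" by blast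
    then show ?thesis
    proof cases
      case 1
      then show ?thesis using row_1_floor j by (simp add: apart_def)
    next
      case 2
      then have "y 2 + ht d 2 \<le> y j" using row_below[OF two _ _ True] \<open>j \<noteq> 2\<close> by simp
      then show ?thesis using high by (simp add: apart_def)
    qed
  qed (auto simp: apart_def overlap_def)
  then have "y 2 < 1 \<or> (y 2 = 1 \<and> x 2 \<le> x 2)" using strip[of 2] by (intro lex_least) auto
  then show False using high by auto
qed

text \<open>Row 1 is gapless, so some item of height at least 1 lies under item 3.\<close>

lemma high_item_bottom: "1 \<le> y 3"
proof -
  obtain j where j: "j \<in> row 1" "overlap j 3" using row_overlap_exists[of 3 1] by auto
  moreover have "3 \<in> row 2" by (simp add: row_2)
  ultimately have "y j + ht d j \<le> y 3"
    using row_below[of j 1 3 2] small_item_row_2(1)[of 3] by auto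
  then show ?thesis using strip[of j] j row_less[of j] ht_ge_1[OF d, of j] by force
qed

text \<open>Of the top-row items above \<open>z\<close>, the first one to be placed could have been put
  left-aligned directly onto \<open>z\<close>.\<close>

lemma first_item_above:
  assumes z: "z \<in> row 2" "z \<notin> row 3" "wd z = 4"
  obtains k where "k \<in> row 3" "overlap z k" "y k = y z + ht d z" "x k \<le> x z" "4 \<le> k"
proof -
  define S where "S = {k \<in> row 3. overlap z k}"
  have z10: "z < 10" using z row_less by blast
  have "S \<noteq> {}" using row_overlap_exists[OF z10, of 3] by (auto simp: S_def overlap_def)
  then obtain k where k: "k \<in> S" "\<And>j. j \<in> S \<Longrightarrow> tm k \<le> tm j"
    using exists_least_iff[of "\<lambda>n. \<exists>k\<in>S. tm k = n"] by (metis ex_in_conv not_le)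
  have k3: "k \<in> row 3" and ov: "overlap z k" using k by (auto simp: S_def)
  have "k \<noteq> z" using k3 z by auto
  then have above: "y z + ht d z \<le> y k" using row_below[OF z(1) k3 _ ov] by simp
  have "k \<notin> row 2" using \<open>k \<noteq> z\<close> row_no_overlap[OF z(1)] ov by blast
  then have k4: "4 \<le> k" by (simp add: row_2)
  then have wk: "wd k = 3" by (simp add: wd_def)
  have "apart (wd k, ht d k) (x z, y z + ht d z) (wd j, ht d j) (x j, y j)"
    if "j < 10" "tm j < tm k" for j
  \<comment> \<open>By minimality of \<open>tm k\<close>, an earlier item overlapping
    \<open>z\<close>, other than \<open>z\<close> itself, can only come from row 1, below
    \<open>z\<close>.\<close>
  proof (cases "overlap z j \<and> j \<noteq> z")
    case True
    then have "j \<notin> row 2" using row_no_overlap[OF z(1)] by blast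
    moreover have "j \<notin> row 3" using True k(2)[of j] that by (auto simp: S_def)
    ultimately have "j \<in> row 1" using in_some_row[OF that(1)] by blast
    then have "y j + ht d j \<le> y z"
      using row_below[of j 1 z 2] z True by (simp add: overlap_def)
    then show ?thesis using ht_ge_1[OF d, of z] by (auto simp: apart_def)
  \<comment> \<open>The new spot has width 3 and lies within the width 4 of \<open>z\<close>, so an
    item clear of \<open>z\<close> horizontally is clear of the spot.\<close>
  qed (use wk z in \<open>auto simp: apart_def overlap_def\<close>)
  then have "y k < y z + ht d z \<or> (y k = y z + ht d z \<and> x k \<le> x z)"
    using strip[OF z10] z wk ht_ge_1[OF d, of z] row_less[OF k3] by (intro lex_least) auto
  then show thesis using that k3 ov above k4 by auto
qed

section \<open>The four layouts and their refutation\<close>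

text \<open>Among the subset sums 0, 1, 4, 5, 8, 9 only 0 and 9 are divisible by 3.\<close>

lemma tall_offset_cases:
  assumes "3 * real n = (if P then 4 else 0) + (if Q then 4 else 0) + (if R then 1 else 0)"
  shows "n = 0 \<or> n = 3"
proof -
  have "real (3 * n) = real ((if P then 4 else 0) + (if Q then 4 else 0) + (if R then 1 else 0))"
    using assms by simp
  then have "3 * n = (if P then 4 else 0) + (if Q then 4 else 0) + (if R then 1 else 0)"
    by (simp only: of_nat_eq_iff)
  then show ?thesis by (auto split: if_splits) presburger+
qed

lemma contradiction: False
proof -
  obtain l u where lu: "(l, u) = (0, 1) \<or> (l, u) = (1, 0)"
    and l: "row 1 \<inter> {..<4} = {l}" and u: "row 3 \<inter> {..<4} = {u}"
    by (rule tall_split)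
  have l1: "l \<in> row 1" and u3: "u \<in> row 3" using l u by auto
  have wl: "wd l = 4" "wd u = 4" "wd 2 = 4" "wd 3 = 1" and
    hl: "ht d l = 2 + d" "ht d 2 = 1" "ht d 3 = 1 + 2 * d"
    using lu by (auto simp: wd_def ht_def)
  have row2: "row 2 = {l, u, 2, 3}" and ne: "l \<noteq> u" "l \<noteq> 2" "l \<noteq> 3" "u \<noteq> 2" "u \<noteq> 3"
    using lu by (auto simp: row_2)
  have yl: "y l = 0" using row_1_floor[OF l1] .
  obtain n where n: "x l = 3 * real n" using outer_row_position[OF _ l l1] by auto
  obtain m where m: "x u = 3 * real m" using outer_row_position[OF _ u u3] by auto
  have pos: "x k = (\<Sum>j\<in>{l, u, 2, 3} - {k}. if x j < x k then wd j else 0)"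
    if "k \<in> {l, u, 2, 3}" for k
    using row_position[of k 2] that by (simp add: row2)
  have xl: "x l = (if x u < x l then 4 else 0) + (if x 2 < x l then 4 else 0)
     + (if x 3 < x l then 1 else 0)"
    using pos[of l] ne by (simp add: insert_Diff_if wl cong: if_cong)
  have xu: "x u = (if x l < x u then 4 else 0) + (if x 2 < x u then 4 else 0)
     + (if x 3 < x u then 1 else 0)"
    using pos[of u] ne by (simp add: insert_Diff_if wl cong: if_cong)
  have x2: "x 2 = (if x l < x 2 then 4 else 0) + (if x u < x 2 then 4 else 0)
     + (if x 3 < x 2 then 1 else 0)"
    using pos[of 2] ne by (simp add: insert_Diff_if wl cong: if_cong)
  have x3: "x 3 = (if x l < x 3 then 4 else 0) + (if x u < x 3 then 4 else 0)
     + (if x 2 < x 3 then 4 else 0)"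
    using pos[of 3] ne by (simp add: insert_Diff_if wl cong: if_cong)
  \<comment> \<open>Each tall item has two descriptions of its offset: a multiple of 3 from its
    outer row, a subset sum of 4, 4, 1 from row 2.\<close>
  have xl': "x l = 0 \<or> x l = 9" using tall_offset_cases[OF trans[OF n[symmetric] xl]] n by auto
  have xu': "x u = 0 \<or> x u = 9" using tall_offset_cases[OF trans[OF m[symmetric] xu]] m by auto
  have distinct_x: "x j \<noteq> x k" if "j \<in> row 2" "k \<in> row 2" "j \<noteq> k" for j k
    using row_disjoint[OF that] wd_bounds(1)[of j] wd_bounds(1)[of k] by auto
  have "x l \<noteq> x u" using distinct_x[of l u] ne by (simp add: row2)
  then have ends: "x l = 0 \<and> x u = 9 \<or> x l = 9 \<and> x u = 0" using xl' xu' by auto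
  have between: "4 \<le> x k" "x k + wd k \<le> 9" if "k \<in> {2, 3}" for k
  proof -
    have k: "k \<in> row 2" "k \<noteq> l" "k \<noteq> u" "0 < wd k" "0 \<le> x k" "x k + wd k \<le> 13"
      using that ne wd_bounds(1)[of k] strip[of k] by (auto simp: row2)
    have "x l + 4 \<le> x k \<or> x k + wd k \<le> x l" "x u + 4 \<le> x k \<or> x k + wd k \<le> x u"
      using row_disjoint[of l 2 k] row_disjoint[of u 2 k] k wl by (auto simp: row2)
    with k ends show "4 \<le> x k" "x k + wd k \<le> 9" by linarith+
  qed
  have b: "4 \<le> x 2" "x 2 < 9" "4 \<le> x 3" "x 3 < 9"
    using between[of 2] between[of 3] wl by simp_all
  \<comment> \<open>Exactly one tall item lies to the left of items 2 and 3 and contributes the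
    leading 4.\<close>
  have "x 2 = 4 + (if x 3 < x 2 then 1 else 0)" "x 3 = 4 + (if x 2 < x 3 then 4 else 0)"
    using ends by (elim disjE; use x2 x3 b in simp)+
  moreover have "x 2 \<noteq> x 3" using distinct_x[of 2 3] by (simp add: row2)
  ultimately have "x 2 = 4 \<and> x 3 = 8 \<or> x 2 = 5 \<and> x 3 = 4"
    by (cases "x 2 < x 3") simp_all
  with ends have config: "(x l = 0 \<and> x u = 9 \<or> x l = 9 \<and> x u = 0) \<and>
      (x 2 = 4 \<and> x 3 = 8 \<or> x 2 = 5 \<and> x 3 = 4)" by blast
  \<comment> \<open>The tall item \<open>u\<close> is at one end of the strip, so the shift by 4
    applies to all the width-3 items of row 3 or to none.\<close>
  have pitch: "\<exists>n. x k = real ((if x u = 0 then 4 else 0) + 3 * n)"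
    if k: "k \<in> row 3" "4 \<le> k" for k
  proof -
    have "k \<noteq> u" and wk: "wd k = 3" using lu k by (auto simp: wd_def)
    then have side: "x k + 3 \<le> x u \<or> x u + 4 \<le> x k"
      using row_disjoint[OF k(1) u3] wl by simp
    have range: "0 \<le> x k" "x k + 3 \<le> 13" using strip[of k] row_less[OF k(1)] wk by simp_all
    obtain n where n: "x k = 3 * real n + (if x u < x k then wd u else 0)"
      using outer_row_position[OF _ u k(1)] \<open>k \<noteq> u\<close> by auto
    from xu' show ?thesis
    proof
      assume "x u = 0"
      then have "x k = real (4 + 3 * n)" using side range n wl by simp
      then show ?thesis using \<open>x u = 0\<close> by auto
    next
      assume "x u = 9"
      then have "x k = real (3 * n)" using side range n wl by simp
      then show ?thesis using \<open>x u = 9\<close> by auto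
    qed
  qed
  \<comment> \<open>The first item \<open>k\<close> above \<open>z\<close> starts strictly left of
    \<open>z\<close>, hence over the adjacent \<open>v\<close>, yet rests at the top of
    \<open>z\<close>, which is lower than that of \<open>v\<close>.\<close>
  have block: False
    if z: "z \<in> {2, l}" and v: "v \<in> {l, 3}" and top: "y z + ht d z < y v + ht d v"
      and adjacent: "x v + wd v = x z"
      and misaligned: "\<And>k. \<lbrakk>k \<in> row 3; 4 \<le> k\<rbrakk> \<Longrightarrow> x k \<noteq> x z"
    for z v
  proof -
    have "z < 4" "z \<noteq> u" using z lu by auto
    then have "z \<notin> row 3" using u by blast
    moreover have "z \<in> row 2" "v \<in> row 2" "wd z = 4" "v < 4"
      using z v wl lu by (auto simp: row2)
    ultimately obtain k where
      k: "k \<in> row 3" "overlap z k" "y k = y z + ht d z" "x k \<le> x z" "4 \<le> k"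
      using first_item_above[of z] by blast
    have "x k < x z" using misaligned[OF k(1,5)] k(4) by simp
    then have "overlap v k"
      using adjacent k(2) wd_bounds(1)[of v] by (simp add: overlap_def)
    then have "y v + ht d v \<le> y k"
      using row_below[OF \<open>v \<in> row 2\<close> k(1)] k(5) \<open>v < 4\<close> by simp
    then show False using top k(3) by simp
  qed
  have H: "2 + 2 * d \<le> y 3 + ht d 3" using high_item_bottom hl by simp
  have L: "y 2 + ht d 2 \<le> 2" using low_item_bottom hl by simp
  have not_mult: "3 * n \<noteq> 4" "3 * n \<noteq> 5" "4 + 3 * n \<noteq> 5" "4 + 3 * n \<noteq> 9" for n :: nat
    by presburger+
  have misaligned: "x k \<noteq> real b"
    if "k \<in> row 3" "4 \<le> k" "\<And>n. (if x u = 0 then 4 else 0) + 3 * n \<noteq> b" for k b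
  proof
    assume "x k = real b"
    moreover obtain n where "x k = real ((if x u = 0 then 4 else 0) + 3 * n)"
      using pitch[OF \<open>k \<in> row 3\<close> \<open>4 \<le> k\<close>] by blast
    ultimately show False using that(3)[of n] by (simp only: of_nat_eq_iff)
  qed
  \<comment> \<open>The second case covers both placements of the tall items.\<close>
  from config consider "x l = 0" "x u = 9" "x 2 = 4" | "x 2 = 5" "x 3 = 4"
    | "x l = 9" "x u = 0" "x 3 = 8" by blast
  then show False
  proof cases
    case 1
    have "x k \<noteq> x 2" if "k \<in> row 3" "4 \<le> k" for k
      using misaligned[OF that, of 4] 1 not_mult by simp
    then show ?thesis using block[of 2 l] L yl hl(1) d 1 wl by simp
  next
    case 2
    have "x k \<noteq> x 2" if "k \<in> row 3" "4 \<le> k" for k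
      using misaligned[OF that, of 5] 2 not_mult by simp
    then show ?thesis using block[of 2 3] L H d 2 wl by simp
  next
    case 3
    have "x k \<noteq> x l" if "k \<in> row 3" "4 \<le> k" for k
      using misaligned[OF that, of 9] 3 not_mult by simp
    then show ?thesis using block[of l 3] H yl hl(1) d 3 wl by simp
  qed
qed

end

section \<open>From the abstract setting to bottom-left packings\<close>

text \<open>The bijection \<open>g\<close> sends an item to its index in the ordering
  \<open>rs\<close>, which also serves as its placement time; \<open>c\<close> is a quarter of the
  height.\<close>

lemma BL_output_items_height:
  assumes d: "0 < d" and perm: "mset rs = mset (items d)" and BL: "BL_output 13 rs ps"
  shows "4 \<le> packing_height rs ps"
proof (rule ccontr)
  assume low: "\<not> 4 \<le> packing_height rs ps"
  have len: "length rs = 10" using mset_eq_length[OF perm] by simp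
  obtain g where g: "bij_betw g {..<10} {..<10}" "\<And>k. k < 10 \<Longrightarrow> items d ! k = rs ! (g k)"
    using permutation_Ex_bij[of "items d" rs] perm len by auto
  have g10: "g k < 10" if "k < 10" for k using g(1) that by (auto simp: bij_betw_def)
  have g_inj: "g j \<noteq> g k" if "j < 10" "k < 10" "j \<noteq> k" for j k
    using g(1) that by (auto simp: bij_betw_def inj_on_def)
  have rs: "rs ! (g k) = (wd k, ht d k)" if "k < 10" for k using g(2)[OF that] that by simp
  have f: "feasible 13 rs ps" using BL_output_feasible[OF BL] len by simp
  have apart: "disjoint_open (wd j, ht d j) p (wd k, ht d k) q \<longleftrightarrow>
     apart (wd j, ht d j) p (wd k, ht d k) q" for j k p q
    using wd_bounds ht_ge_1[OF d, of j] ht_ge_1[OF d, of k] by (intro disjoint_open_iff_apart) auto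
  have height: "snd (ps ! g k) + ht d k \<le> packing_height rs ps" if "k < 10" for k
    using packing_height_ge[of "g k" rs ps] g10[OF that] rs[OF that] len by simp
  have strip: "0 \<le> fst (ps ! g k)" "fst (ps ! g k) + wd k \<le> 13" "0 \<le> snd (ps ! g k)"
    if "k < 10" for k
    using f g10[OF that] rs[OF that] len by (force simp: feasible_def)+
  have pos: "0 < packing_height rs ps"
    using height[of 0] strip(3)[of 0] ht_ge_1[OF d, of 0] by simp
  interpret low_packing d "packing_height rs ps / 4" "\<lambda>k. fst (ps ! g k)" "\<lambda>k. snd (ps ! g k)" g
  proof
    show "0 < d" by fact
    show "0 < packing_height rs ps / 4" "packing_height rs ps / 4 < 1" using pos low by auto
  next
    fix k :: nat assume "k < 10"
    then show "0 \<le> fst (ps ! g k) \<and> fst (ps ! g k) + wd k \<le> 13 \<and> 0 \<le> snd (ps ! g k) \<and>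
      snd (ps ! g k) + ht d k \<le> 4 * (packing_height rs ps / 4)"
      using strip height by simp
  next
    fix j k :: nat assume jk: "j < 10" "k < 10" "j \<noteq> k"
    then have "disjoint_open (rs ! g j) (ps ! g j) (rs ! g k) (ps ! g k)"
      using f g10 g_inj len by (simp add: feasible_def)
    then show "apart (wd j, ht d j) (fst (ps ! g j), snd (ps ! g j))
       (wd k, ht d k) (fst (ps ! g k), snd (ps ! g k))"
      using jk rs apart by simp
  next
    fix k :: nat and a b :: real
    assume k: "k < 10" and ab: "0 \<le> a" "a + wd k \<le> 13" "0 \<le> b"
      and free: "\<And>j. j < 10 \<Longrightarrow> g j < g k \<Longrightarrow>
        apart (wd k, ht d k) (a, b) (wd j, ht d j) (fst (ps ! g j), snd (ps ! g j))"
    have "disjoint_open (rs ! g k) (a, b) (rs ! i) (ps ! i)" if "i < g k" for i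
    proof -
      have "i \<in> g ` {..<10}" using g(1) that g10[OF k] by (simp add: bij_betw_def)
      then obtain j where "j < 10" "i = g j" by auto
      then show ?thesis using free[of j] that rs k apart by simp
    qed
    then have "lex_yx_le (ps ! g k) (a, b)"
      using k ab rs g10 len by (intro BL_output_lex_least[OF BL f]) auto
    then show "snd (ps ! g k) < b \<or> (snd (ps ! g k) = b \<and> fst (ps ! g k) \<le> a)"
      by (simp add: lex_yx_le_def)
  qed
  show False by (rule contradiction)
qed

theorem theorem4:
  fixes \<epsilon> :: real
  assumes "\<epsilon> > 0"
  shows "\<exists>W rs. valid_instance W rs \<and> h_BL_best W rs / h_OPT W rs \<ge> 4/3 - \<epsilon>"
proof (intro exI conjI)
  show "valid_instance 13 (items \<epsilon>)"
  proof -
    have "items \<epsilon> \<noteq> []" using length_items[of \<epsilon>] by force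
    then show ?thesis using items_valid[OF _ assms] by (simp add: valid_instance_def)
  qed
  obtain ps where "BL_output 13 (items \<epsilon>) ps"
    using BL_output_exists[of "items \<epsilon>" 13] items_valid[OF _ assms] by blast
  then have BL: "4 \<le> h_BL_best 13 (items \<epsilon>)"
    unfolding h_BL_best_def using BL_output_items_height[OF assms]
    by (intro cInf_greatest) auto
  \<comment> \<open>Multiplied out, the left side times \<open>3 + 2 * \<epsilon>\<close> is
    \<open>4 - \<epsilon> / 3 - 2 * \<epsilon>^2\<close>.\<close>
  have "4 / 3 - \<epsilon> \<le> 4 / (3 + 2 * \<epsilon>)"
    using assms by (simp add: field_simps)
  also have "\<dots> \<le> h_BL_best 13 (items \<epsilon>) / h_OPT 13 (items \<epsilon>)"
    using BL h_OPT_items[OF assms] by (intro frac_le) auto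
  finally show "h_BL_best 13 (items \<epsilon>) / h_OPT 13 (items \<epsilon>) \<ge> 4/3 - \<epsilon>" .
qed

end
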